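(* Let $A$ be a simple AH-algebra, given with an inductive limit decomposition whose eigenvalue patterns are induced by continuous maps. If $A$ has the small boundary refinement property (SBRP), then $A$ has mean dimension zero.
   Context: **Setting.** $A=\varinjlim(A_i,\varphi_i)$ is the inductive limit of a sequence of unital C*-algebras $A_i=\bigoplus_{l=1}^{h_i}A_{i,l}$, $A_{i,l}=p_{i,l}\mathrm{M}_{r_{i,l}}(\mathrm{C}(X_{i,l}))p_{i,l}$, with unital connecting maps $\varphi_{i,j}:A_i\to A_j$, where each $X_{i,l}$ is a connected compact metrizable space with a fixed compatible metric and $p_{i,l}$ is a projection of rank $n_{i,l}$. The eigenvalue patterns are assumed to be induced by continuous maps: for all $i<j$, $l$, $k$ there are continuous maps $\lambda_{i,j}^{l,k}(m):X_{j,k}\to X_{i,l}$, $1\le m\le m_{i,j}^{l,k}$, such that for every $x\in X_{j,k}$ the points of $X_{i,l}$ (counted with multiplicity) corresponding to the representation of $A_{i,l}$ given by $\varphi_{i,j}$ followed by evaluation at $x$ are $\lambda_{i,j}^{l,k}(1)(x),\dots,\lambda_{i,j}^{l,k}(m_{i,j}^{l,k})(x)$. **Mean dimension.** For a finite open cover $\alpha$ of a space $X$ let $\mathrm{ord}(\alpha)=\max_{x\in X}\big(\sum_{U\in\alpha}1_U(x)\big)-1$ and $\mathcal D(\alpha)=\min\{\mathrm{ord}(\beta):\beta\text{ a finite open cover refining }\alpha\}$. Covers $\alpha\vee\beta$ consist of the sets $U\cap V$, $U\in\alpha$, $V\in\beta$. Let $X_i=\bigsqcup_lX_{i,l}$.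 For a finite open cover $\alpha$ of $X_i$, each member of which is contained in a connected component, inducing covers $\alpha_l$ of $X_{i,l}$, put $\varphi_{i,j}^k(\alpha)=\bigvee_{l}\bigvee_{m}(\lambda_{i,j}^{l,k}(m))^{-1}(\alpha_l)$, an open cover of $X_{j,k}$. Set $\gamma_i(A)=\sup_{\alpha}\lim_{j\to\infty}\max_{1\le k\le h_j}\mathcal D(\varphi_{i,j}^k(\alpha))/n_{j,k}$ (the limit exists since the sequence is decreasing in $j$). The mean dimension is $\gamma(A)=\lim_i\gamma_i(A)$ (an increasing limit). **SBRP.** For a closed set $E\subseteq X_{i,l}$ and $j\ge i$, put $$\mathrm{ocap}_{j,k}(E)=\sup_{x\in X_{j,k}}\frac{n_{i,l}}{n_{j,k}}\#\{1\le m\le m_{i,j}^{l,k}:\lambda_{i,j}^{l,k}(m)(x)\in E\}.$$ $A$ has the small boundary refinement property if for any $X_{i,l}$, any finite open cover $\alpha$ of $X_{i,l}$ and any $\varepsilon>0$ there exists $L$ such that for any $X_{j,k}$ with $j>L$ there are an open cover $\alpha'$ of $X_{i,l}$ refining $\alpha$ and $\delta>0$ (both may depend on $X_{j,k}$) such that there is a one-to-one correspondence between elements $U\in\alpha$ and $U'\in\alpha'$ with $\overline{U'}\subseteq U$, and $\mathrm{ocap}_{j,k}\big(\bigcup_{U'\in\alpha'}\mathrm{B}(\partial U',\delta)\big)<\varepsilon$, where $\mathrm{B}(\partial U',\delta)$ is the closed $\delta$-neighbourhood of $\partial U'$. *)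

theory Defs
  imports
    "HOL-Analysis.Abstract_Metric_Spaces"
    "HOL-Library.Extended_Real"
    "HOL-Algebra.Ideal"
    "Jordan_Normal_Form.DL_Rank"
    "Jordan_Normal_Form.Schur_Decomposition"
begin

record 'a cstar = "'a ring" +
  cscale :: "complex \<Rightarrow> 'a \<Rightarrow> 'a"
  star :: "'a \<Rightarrow> 'a"
  cnorm :: "'a \<Rightarrow> real"

definition cdist :: "('a, 'm) cstar_scheme \<Rightarrow> 'a \<Rightarrow> 'a \<Rightarrow> real" where
  "cdist A a b = cnorm A (a \<ominus>\<^bsub>A\<^esub> b)"

definition cnorm_topology :: "('a, 'm) cstar_scheme \<Rightarrow> 'a topology" where
  "cnorm_topology A = Metric_space.mtopology (carrier A) (cdist A)"

locale unital_cstar_algebra = ring A for A :: "('a, 'm) cstar_scheme" (structure) +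
  assumes cscale_closed: "a \<in> carrier A \<Longrightarrow> cscale A c a \<in> carrier A"
    and cscale_add_right:
      "\<lbrakk>a \<in> carrier A; b \<in> carrier A\<rbrakk> \<Longrightarrow> cscale A c (a \<oplus> b) = cscale A c a \<oplus> cscale A c b"
    and cscale_add_left:
      "a \<in> carrier A \<Longrightarrow> cscale A (c + d) a = cscale A c a \<oplus> cscale A d a"
    and cscale_cscale: "a \<in> carrier A \<Longrightarrow> cscale A c (cscale A d a) = cscale A (c * d) a"
    and cscale_one: "a \<in> carrier A \<Longrightarrow> cscale A 1 a = a"
    and cscale_mult_left:
      "\<lbrakk>a \<in> carrier A; b \<in> carrier A\<rbrakk> \<Longrightarrow> cscale A c a \<otimes> b = cscale A c (a \<otimes> b)"
    and cscale_mult_right: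
      "\<lbrakk>a \<in> carrier A; b \<in> carrier A\<rbrakk> \<Longrightarrow> a \<otimes> cscale A c b = cscale A c (a \<otimes> b)"
    and star_closed: "a \<in> carrier A \<Longrightarrow> star A a \<in> carrier A"
    and star_star: "a \<in> carrier A \<Longrightarrow> star A (star A a) = a"
    and star_add:
      "\<lbrakk>a \<in> carrier A; b \<in> carrier A\<rbrakk> \<Longrightarrow> star A (a \<oplus> b) = star A a \<oplus> star A b"
    and star_mult:
      "\<lbrakk>a \<in> carrier A; b \<in> carrier A\<rbrakk> \<Longrightarrow> star A (a \<otimes> b) = star A b \<otimes> star A a"
    and star_cscale: "a \<in> carrier A \<Longrightarrow> star A (cscale A c a) = cscale A (cnj c) (star A a)"
    and cnorm_nonneg: "a \<in> carrier A \<Longrightarrow> 0 \<le> cnorm A a"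
    and cnorm_eq_0_iff: "a \<in> carrier A \<Longrightarrow> cnorm A a = 0 \<longleftrightarrow> a = \<zero>"
    and cnorm_triangle:
      "\<lbrakk>a \<in> carrier A; b \<in> carrier A\<rbrakk> \<Longrightarrow> cnorm A (a \<oplus> b) \<le> cnorm A a + cnorm A b"
    and cnorm_cscale: "a \<in> carrier A \<Longrightarrow> cnorm A (cscale A c a) = cmod c * cnorm A a"
    and cnorm_mult:
      "\<lbrakk>a \<in> carrier A; b \<in> carrier A\<rbrakk> \<Longrightarrow> cnorm A (a \<otimes> b) \<le> cnorm A a * cnorm A b"
    and cstar_identity: "a \<in> carrier A \<Longrightarrow> cnorm A (star A a \<otimes> a) = (cnorm A a)\<^sup>2"
    and cnorm_complete: "Metric_space.mcomplete (carrier A) (cdist A)"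

definition unital_star_hom ::
    "('a, 'm) cstar_scheme \<Rightarrow> ('b, 'k) cstar_scheme \<Rightarrow> ('a \<Rightarrow> 'b) set" where
  "unital_star_hom A B =
     {f \<in> Ring.ring_hom A B.
        (\<forall>c. \<forall>a \<in> carrier A. f (cscale A c a) = cscale B c (f a)) \<and>
        (\<forall>a \<in> carrier A. f (star A a) = star B (f a))}"

text \<open>In a unital algebra a two-sided ring ideal is automatically a complex subspace.\<close>

definition simple_cstar_algebra :: "('a, 'm) cstar_scheme \<Rightarrow> bool" where
  "simple_cstar_algebra A \<longleftrightarrow>
     carrier A \<noteq> {\<zero>\<^bsub>A\<^esub>} \<and>
     (\<forall>I. Ideal.ideal I A \<and> closedin (cnorm_topology A) I \<longrightarrow> I = {\<zero>\<^bsub>A\<^esub>} \<or> I = carrier A)"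

definition cstar_direct_sum :: "nat \<Rightarrow> (nat \<Rightarrow> 'a cstar) \<Rightarrow> (nat \<Rightarrow> 'a) cstar" where
  "cstar_direct_sum h B =
     \<lparr>carrier = (\<Pi>\<^sub>E l\<in>{..<h}. carrier (B l)),
      monoid.mult = (\<lambda>a b. \<lambda>l\<in>{..<h}. a l \<otimes>\<^bsub>B l\<^esub> b l),
      one = (\<lambda>l\<in>{..<h}. \<one>\<^bsub>B l\<^esub>),
      zero = (\<lambda>l\<in>{..<h}. \<zero>\<^bsub>B l\<^esub>),
      add = (\<lambda>a b. \<lambda>l\<in>{..<h}. a l \<oplus>\<^bsub>B l\<^esub> b l),
      cscale = (\<lambda>c a. \<lambda>l\<in>{..<h}. cscale (B l) c (a l)),
      star = (\<lambda>a. \<lambda>l\<in>{..<h}. star (B l) (a l)),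
      cnorm = (\<lambda>a. Max ((\<lambda>l. cnorm (B l) (a l)) ` {..<h}))\<rparr>"

definition direct_sum_incl :: "nat \<Rightarrow> (nat \<Rightarrow> 'a cstar) \<Rightarrow> nat \<Rightarrow> 'a \<Rightarrow> (nat \<Rightarrow> 'a)" where
  "direct_sum_incl h B l a = (\<lambda>l'\<in>{..<h}. if l' = l then a else \<zero>\<^bsub>B l'\<^esub>)"


definition cvec_norm :: "complex vec \<Rightarrow> real" where
  "cvec_norm v = sqrt (\<Sum>i<dim_vec v. (cmod (v $ i))\<^sup>2)"

definition op_norm :: "complex mat \<Rightarrow> real" where
  "op_norm M = (SUP v \<in> {v \<in> carrier_vec (dim_col M). cvec_norm v \<le> 1}. cvec_norm (M *\<^sub>v v))"

definition continuous_mat_fun :: "'x metric \<Rightarrow> nat \<Rightarrow> ('x \<Rightarrow> complex mat) \<Rightarrow> bool" where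
  "continuous_mat_fun X r f \<longleftrightarrow>
     (\<forall>x \<in> mspace X. f x \<in> carrier_mat r r) \<and>
     (\<forall>u<r. \<forall>v<r. continuous_map (mtopology_of X) euclidean (\<lambda>x. f x $$ (u, v)))"

definition projection_of_rank :: "'x metric \<Rightarrow> nat \<Rightarrow> nat \<Rightarrow> ('x \<Rightarrow> complex mat) \<Rightarrow> bool" where
  "projection_of_rank X r n p \<longleftrightarrow>
     continuous_mat_fun X r p \<and>
     (\<forall>x \<in> mspace X. p x * p x = p x \<and> mat_adjoint (p x) = p x \<and> vec_space.rank r (p x) = n)"

definition corner_algebra ::
    "'x metric \<Rightarrow> nat \<Rightarrow> ('x \<Rightarrow> complex mat) \<Rightarrow> ('x \<Rightarrow> complex mat) cstar" where
  "corner_algebra X r p =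
     \<lparr>carrier = {f \<in> extensional (mspace X).
                   continuous_mat_fun X r f \<and> (\<forall>x \<in> mspace X. p x * f x * p x = f x)},
      monoid.mult = (\<lambda>f g. \<lambda>x\<in>mspace X. f x * g x),
      one = (\<lambda>x\<in>mspace X. p x),
      zero = (\<lambda>x\<in>mspace X. 0\<^sub>m r r),
      add = (\<lambda>f g. \<lambda>x\<in>mspace X. f x + g x),
      cscale = (\<lambda>c f. \<lambda>x\<in>mspace X. c \<cdot>\<^sub>m f x),
      star = (\<lambda>f. \<lambda>x\<in>mspace X. mat_adjoint (f x)),
      cnorm = (\<lambda>f. SUP x \<in> mspace X. op_norm (f x))\<rparr>"


text \<open>Index sets are 0-based: \<open>l < summands S i\<close> for the summands of the \<open>i\<close>-th algebra.
  In the notation of the mathematics: \<open>summands S i\<close> is $h_i$, \<open>base S i l\<close> is $X_{i,l}$ with its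
  fixed metric, \<open>msize S i l\<close> is $r_{i,l}$, \<open>prj S i l\<close> is $p_{i,l}$, \<open>rk S i l\<close> is $n_{i,l}$,
  and \<open>cmap S i\<close> is the connecting map from the \<open>i\<close>-th to the \<open>Suc i\<close>-th algebra.\<close>

record 'x ah_system =
  summands :: "nat \<Rightarrow> nat"
  base :: "nat \<Rightarrow> nat \<Rightarrow> 'x metric"
  msize :: "nat \<Rightarrow> nat \<Rightarrow> nat"
  prj :: "nat \<Rightarrow> nat \<Rightarrow> 'x \<Rightarrow> complex mat"
  rk :: "nat \<Rightarrow> nat \<Rightarrow> nat"
  cmap :: "nat \<Rightarrow> (nat \<Rightarrow> 'x \<Rightarrow> complex mat) \<Rightarrow> (nat \<Rightarrow> 'x \<Rightarrow> complex mat)"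

text \<open>\<open>npts S i j l k\<close> is $m_{i,j}^{l,k}$ and \<open>eig S i j l k m\<close>, for \<open>m < npts S i j l k\<close>,
  is $\lambda_{i,j}^{l,k}(m+1)$.\<close>

record 'x ah_eig_system = "'x ah_system" +
  npts :: "nat \<Rightarrow> nat \<Rightarrow> nat \<Rightarrow> nat \<Rightarrow> nat"
  eig :: "nat \<Rightarrow> nat \<Rightarrow> nat \<Rightarrow> nat \<Rightarrow> nat \<Rightarrow> 'x \<Rightarrow> 'x"

abbreviation base_top :: "('x, 'm) ah_system_scheme \<Rightarrow> nat \<Rightarrow> nat \<Rightarrow> 'x topology" where
  "base_top S i l \<equiv> mtopology_of (base S i l)"

definition summand_algebra ::
    "('x, 'm) ah_system_scheme \<Rightarrow> nat \<Rightarrow> nat \<Rightarrow> ('x \<Rightarrow> complex mat) cstar" where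
  "summand_algebra S i l = corner_algebra (base S i l) (msize S i l) (prj S i l)"

definition stage_algebra ::
    "('x, 'm) ah_system_scheme \<Rightarrow> nat \<Rightarrow> (nat \<Rightarrow> 'x \<Rightarrow> complex mat) cstar" where
  "stage_algebra S i = cstar_direct_sum (summands S i) (summand_algebra S i)"

definition is_ah_system :: "('x, 'm) ah_system_scheme \<Rightarrow> bool" where
  "is_ah_system S \<longleftrightarrow>
     (\<forall>i. 1 \<le> summands S i \<and>
        (\<forall>l < summands S i.
           mspace (base S i l) \<noteq> {} \<and>
           compact_space (base_top S i l) \<and>
           connected_space (base_top S i l) \<and>
           1 \<le> rk S i l \<and>
           projection_of_rank (base S i l) (msize S i l) (rk S i l) (prj S i l)) \<and>
        cmap S i \<in> unital_star_hom (stage_algebra S i) (stage_algebra S (Suc i)))"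

primrec conn :: "('x, 'm) ah_system_scheme \<Rightarrow> nat \<Rightarrow> nat
    \<Rightarrow> (nat \<Rightarrow> 'x \<Rightarrow> complex mat) \<Rightarrow> (nat \<Rightarrow> 'x \<Rightarrow> complex mat)" where
  "conn S i 0 = id"
| "conn S i (Suc d) = cmap S (i + d) \<circ> conn S i d"

definition connecting :: "('x, 'm) ah_system_scheme \<Rightarrow> nat \<Rightarrow> nat
    \<Rightarrow> (nat \<Rightarrow> 'x \<Rightarrow> complex mat) \<Rightarrow> (nat \<Rightarrow> 'x \<Rightarrow> complex mat)" where
  "connecting S i j = conn S i (j - i)"

text \<open>\<open>A\<close> with the canonical maps \<open>\<psi> i\<close> is the C*-algebraic inductive limit: the completion of the
  algebraic direct limit for the seminorm \<open>a \<mapsto> lim\<^sub>j \<parallel>\<phi>\<^sub>i\<^sub>j a\<parallel>\<close> (modulo its null space).  The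
  conditions determine \<open>(A, \<psi>)\<close> up to a unique isomorphism.\<close>

definition is_inductive_limit :: "('x, 'm) ah_system_scheme \<Rightarrow> ('a, 'k) cstar_scheme
    \<Rightarrow> (nat \<Rightarrow> (nat \<Rightarrow> 'x \<Rightarrow> complex mat) \<Rightarrow> 'a) \<Rightarrow> bool" where
  "is_inductive_limit S A \<psi> \<longleftrightarrow>
     unital_cstar_algebra A \<and>
     (\<forall>i. \<psi> i \<in> unital_star_hom (stage_algebra S i) A) \<and>
     (\<forall>i. \<forall>a \<in> carrier (stage_algebra S i). \<psi> (Suc i) (cmap S i a) = \<psi> i a) \<and>
     (\<forall>i. \<forall>a \<in> carrier (stage_algebra S i).
        (\<lambda>j. cnorm (stage_algebra S j) (connecting S i j a)) \<longlonglongrightarrow> cnorm A (\<psi> i a)) \<and>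
     cnorm_topology A closure_of (\<Union>i. \<psi> i ` carrier (stage_algebra S i)) = carrier A"


text \<open>A representation \<open>\<rho>\<close> of \<open>p M\<^sub>r(C(X)) p\<close> by \<open>s \<times> s\<close> matrices corresponds to the points
  \<open>y 0, \<dots>, y (N - 1)\<close>, counted with multiplicity, if it is unitarily equivalent to the direct sum
  of the irreducible point evaluations at these points (and a zero representation).  The partial
  isometry \<open>W m\<close> with initial projection \<open>p (y m)\<close> intertwines evaluation at \<open>y m\<close> with the
  corresponding subrepresentation of \<open>\<rho>\<close>; the ranges of the \<open>W m\<close> are mutually orthogonal.\<close>

definition rep_has_points :: "'x metric \<Rightarrow> nat \<Rightarrow> ('x \<Rightarrow> complex mat) \<Rightarrow> nat
    \<Rightarrow> (('x \<Rightarrow> complex mat) \<Rightarrow> complex mat) \<Rightarrow> nat \<Rightarrow> (nat \<Rightarrow> 'x) \<Rightarrow> bool" where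
  "rep_has_points X r p s \<rho> N y \<longleftrightarrow>
     (\<forall>m<N. y m \<in> mspace X) \<and>
     (\<exists>W :: nat \<Rightarrow> complex mat.
        (\<forall>m<N. W m \<in> carrier_mat s r \<and> mat_adjoint (W m) * W m = p (y m)) \<and>
        (\<forall>m<N. \<forall>m'<N. m \<noteq> m' \<longrightarrow> mat_adjoint (W m) * W m' = 0\<^sub>m r r) \<and>
        (\<forall>a \<in> carrier (corner_algebra X r p).
           \<rho> a = mat s s (\<lambda>uv. \<Sum>m<N. (W m * a (y m) * mat_adjoint (W m)) $$ uv)))"

definition eig_patterns_induced :: "('x, 'm) ah_eig_system_scheme \<Rightarrow> bool" where
  "eig_patterns_induced S \<longleftrightarrow>
     (\<forall>i j l k. i < j \<and> l < summands S i \<and> k < summands S j \<longrightarrow>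
        (\<forall>m < npts S i j l k. continuous_map (base_top S j k) (base_top S i l) (eig S i j l k m)) \<and>
        (\<forall>x \<in> mspace (base S j k).
           rep_has_points (base S i l) (msize S i l) (prj S i l) (msize S j k)
             (\<lambda>a. connecting S i j (direct_sum_incl (summands S i) (summand_algebra S i) l a) k x)
             (npts S i j l k) (\<lambda>m. eig S i j l k m x)))"


definition finite_open_cover :: "'b topology \<Rightarrow> 'b set set \<Rightarrow> bool" where
  "finite_open_cover T \<alpha> \<longleftrightarrow> finite \<alpha> \<and> (\<forall>U \<in> \<alpha>. openin T U) \<and> \<Union>\<alpha> = topspace T"

definition refines :: "'b set set \<Rightarrow> 'b set set \<Rightarrow> bool" where
  "refines \<beta> \<alpha> \<longleftrightarrow> (\<forall>V \<in> \<beta>. \<exists>U \<in> \<alpha>. V \<subseteq> U)"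

text \<open>Natural-number subtraction is harmless: on a nonempty space the maximum is at least 1.\<close>

definition cover_ord :: "'b topology \<Rightarrow> 'b set set \<Rightarrow> nat" where
  "cover_ord T \<alpha> = Max ((\<lambda>x. card {U \<in> \<alpha>. x \<in> U}) ` topspace T) - 1"

definition cover_D :: "'b topology \<Rightarrow> 'b set set \<Rightarrow> nat" where
  "cover_D T \<alpha> = (LEAST d. \<exists>\<beta>. finite_open_cover T \<beta> \<and> refines \<beta> \<alpha> \<and> cover_ord T \<beta> = d)"

text \<open>The join over an empty index set is the trivial cover.\<close>

definition cover_join :: "'b topology \<Rightarrow> 't set \<Rightarrow> ('t \<Rightarrow> 'b set set) \<Rightarrow> 'b set set" where
  "cover_join T I \<C> = (\<lambda>V. topspace T \<inter> (\<Inter>t\<in>I. V t)) ` (\<Pi>\<^sub>E t\<in>I. \<C> t)"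

definition stage_top :: "('x, 'm) ah_system_scheme \<Rightarrow> nat \<Rightarrow> (nat \<times> 'x) topology" where
  "stage_top S i = sum_topology (base_top S i) {..<summands S i}"

definition stage_covers :: "('x, 'm) ah_system_scheme \<Rightarrow> nat \<Rightarrow> (nat \<times> 'x) set set set" where
  "stage_covers S i =
     {\<alpha>. finite_open_cover (stage_top S i) \<alpha> \<and>
          (\<forall>U \<in> \<alpha>. \<exists>C \<in> connected_components_of (stage_top S i). U \<subseteq> C)}"

definition induced_cover :: "(nat \<times> 'x) set set \<Rightarrow> nat \<Rightarrow> 'x set set" where
  "induced_cover \<alpha> l = (\<lambda>U. Pair l -` U) ` \<alpha>"

definition pullback_cover ::
    "('x, 'm) ah_eig_system_scheme \<Rightarrow> nat \<Rightarrow> nat \<Rightarrow> nat \<Rightarrow> (nat \<times> 'x) set set \<Rightarrow> 'x set set" where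
  "pullback_cover S i j k \<alpha> =
     cover_join (base_top S j k) (SIGMA l:{..<summands S i}. {..<npts S i j l k})
       (\<lambda>(l, m). (\<lambda>U. {x \<in> mspace (base S j k). eig S i j l k m x \<in> U}) ` induced_cover \<alpha> l)"

text \<open>The terms with \<open>j \<le> i\<close> are meaningless and do not affect the limit.  As usual, \<open>lim\<close> is
  unspecified for a divergent sequence.\<close>

definition mean_dim_stage :: "('x, 'm) ah_eig_system_scheme \<Rightarrow> nat \<Rightarrow> ereal" where
  "mean_dim_stage S i =
     (SUP \<alpha> \<in> stage_covers S i.
        lim (\<lambda>j. ereal (Max ((\<lambda>k. real (cover_D (base_top S j k) (pullback_cover S i j k \<alpha>))
                                    / real (rk S j k)) ` {..<summands S j}))))"

definition mean_dimension :: "('x, 'm) ah_eig_system_scheme \<Rightarrow> ereal" where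
  "mean_dimension S = lim (mean_dim_stage S)"


definition ocap ::
    "('x, 'm) ah_eig_system_scheme \<Rightarrow> nat \<Rightarrow> nat \<Rightarrow> nat \<Rightarrow> nat \<Rightarrow> 'x set \<Rightarrow> real" where
  "ocap S i l j k E =
     (SUP x \<in> mspace (base S j k).
        real (rk S i l) / real (rk S j k) * real (card {m. m < npts S i j l k \<and> eig S i j l k m x \<in> E}))"

definition closed_nbhd :: "'x metric \<Rightarrow> 'x set \<Rightarrow> real \<Rightarrow> 'x set" where
  "closed_nbhd X E \<delta> = (\<Union>y\<in>E. mcball_of X y \<delta>)"

definition SBRP :: "('x, 'm) ah_eig_system_scheme \<Rightarrow> bool" where
  "SBRP S \<longleftrightarrow>
     (\<forall>i. \<forall>l < summands S i. \<forall>\<alpha> \<epsilon>. finite_open_cover (base_top S i l) \<alpha> \<and> 0 < \<epsilon> \<longrightarrow>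
        (\<exists>L \<ge> i. \<forall>j > L. \<forall>k < summands S j.
           \<exists>\<alpha>' \<delta> f.
             finite_open_cover (base_top S i l) \<alpha>' \<and> refines \<alpha>' \<alpha> \<and> 0 < \<delta> \<and>
             bij_betw f \<alpha> \<alpha>' \<and> (\<forall>U \<in> \<alpha>. base_top S i l closure_of (f U) \<subseteq> U) \<and>
             ocap S i l j k (\<Union>U' \<in> \<alpha>'. closed_nbhd (base S i l) (base_top S i l frontier_of U') \<delta>) < \<epsilon>))"

end

theory Submission
  imports Defs "HOL-Analysis.Urysohn"
begin

text \<open>
  The theorem is the counterpart for AH systems of the fact that a dynamical system with small
  boundaries has mean dimension zero.  A cover of $X_{i,l}$ that has a shrinking
  $U'$ with boundaries of small orbit capacity carries functions $h_U$ that equal 1 on $U'$, vanish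
  off $U$, and take fractional values (strictly between 0 and 1) only near the boundary of $U'$; see
  \<open>bump_family_of_shrinking\<close>.  Composing all of them with all eigenvalue maps
  $X_{j,k} \to X_{i,l}$ gives a map from $X_{j,k}$ to a cube $[0,1]^N$.  By the definition of the
  orbit capacity, at every point of $X_{j,k}$ at most a small multiple of $n_{j,k}$ coordinates
  are fractional: the image lies in a skeleton of the cube whose dimension $d$ is small compared
  with $n_{j,k}$.

  It remains to pull back a cover of order $d$ from that skeleton.  Simply joining the covers
  of the factors would multiply the number of sets that meet at a point, while dimensions have to
  add.  The cover by open stars of vertices in the Freudenthal triangulation of the cube does
  this: a point $y$ with coordinates $g_i(y)$ lies in the star of the vertex $S$ if some level
  $\tau \in (0,1)$ separates the coordinates in $S$ (above $\tau$) from the others (below $\tau$).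
  The $S$ that occur at $y$ form a chain, all members of which contain the coordinates with value 1
  and omit those with value 0, so there are at most $d + 1$ of them (\<open>cover_of_small_order\<close>).
  On such a star every coordinate is either everywhere positive or everywhere below 1.  If all
  coordinates over one eigenvalue map were below 1, then the shrunken sets would miss a point; so
  one of them is positive, which places the star in the preimage of a member of the given cover.
  Thus the stars refine the pulled back cover (\<open>cover_D_join_le\<close>).
\<close>

section \<open>Covers of small order from functions that are rarely fractional\<close>

text \<open>The preimage under \<open>g\<close> of the open star of the vertex \<open>S\<close> in the Freudenthal triangulation of
  the cube over \<open>I\<close>.  The explicit level \<open>\<tau>\<close> avoids minima and maxima over possibly
  empty sets.\<close>

definition cut_region :: "'b topology \<Rightarrow> 'i set \<Rightarrow> ('i \<Rightarrow> 'b \<Rightarrow> real) \<Rightarrow> 'i set \<Rightarrow> 'b set" where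
  "cut_region Y I g S =
     {y \<in> topspace Y. \<exists>\<tau>. 0 < \<tau> \<and> \<tau> < 1 \<and> (\<forall>i\<in>S. \<tau> < g i y) \<and> (\<forall>i\<in>I - S. g i y < \<tau>)}"

text \<open>For a fixed level the region is cut out by finitely many strict inequalities.\<close>

lemma openin_cut_region:
  assumes "finite I" "S \<subseteq> I" and cont: "\<And>i. i \<in> I \<Longrightarrow> continuous_map Y euclideanreal (g i)"
  shows "openin Y (cut_region Y I g S)"
proof -
  define W where "W \<tau> = (\<Inter>i\<in>S. {y \<in> topspace Y. g i y \<in> {\<tau><..}}) \<inter> topspace Y
      \<inter> ((\<Inter>i\<in>I - S. {y \<in> topspace Y. g i y \<in> {..<\<tau>}}) \<inter> topspace Y)" for \<tau>
  have "openin Y (W \<tau>)" for \<tau>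
    unfolding W_def
    by (intro openin_Int openin_INT openin_continuous_map_preimage[OF cont])
      (use assms in \<open>auto intro: finite_subset\<close>)
  then have "openin Y (\<Union>\<tau>\<in>{0<..<1}. W \<tau>)"
    by blast
  moreover have "cut_region Y I g S = (\<Union>\<tau>\<in>{0<..<1}. W \<tau>)"
    unfolding cut_region_def W_def by fastforce
  ultimately show ?thesis by simp
qed

text \<open>Any level that differs from the finitely many values at \<open>y\<close> will do.\<close>

lemma cut_regions_cover:
  assumes "finite I" "y \<in> topspace Y"
  shows "\<exists>S \<subseteq> I. y \<in> cut_region Y I g S"
proof -
  have "infinite ({0<..<1::real} - (\<lambda>i. g i y) ` I)"
    using assms(1) by (simp add: Diff_infinite_finite infinite_Ioo)
  then obtain \<tau> where "\<tau> \<in> {0<..<1} - (\<lambda>i. g i y) ` I"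
    using infinite_imp_nonempty by blast
  then have \<tau>: "0 < \<tau>" "\<tau> < 1" "\<And>i. i \<in> I \<Longrightarrow> g i y \<noteq> \<tau>"
    by auto
  have "y \<in> cut_region Y I g {i \<in> I. \<tau> < g i y}"
    unfolding cut_region_def
  proof (intro CollectI conjI exI[of _ \<tau>])
    show "\<forall>i\<in>I - {i \<in> I. \<tau> < g i y}. g i y < \<tau>"
      using \<tau>(3) by (metis (mono_tags, lifting) Diff_iff linorder_neqE mem_Collect_eq)
  qed (use assms(2) \<tau> in auto)
  then show ?thesis by (intro exI[of _ "{i \<in> I. \<tau> < g i y}"]) simp
qed

text \<open>The sets \<open>S\<close> that occur at \<open>y\<close> are superlevel sets of \<open>i \<mapsto> g i y\<close>, hence form a chain, and
  they differ only in fractional coordinates.  A member of a chain of finite sets is determined by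
  its cardinality, and here there are \<open>d + 1\<close> possible values.\<close>

lemma card_cut_regions_containing_point:
  assumes "finite I" and range: "\<And>i. i \<in> I \<Longrightarrow> 0 \<le> g i y \<and> g i y \<le> 1"
    and d: "card {i \<in> I. 0 < g i y \<and> g i y < 1} \<le> d"
  shows "card {S. S \<subseteq> I \<and> y \<in> cut_region Y I g S} \<le> Suc d"
proof -
  define D where "D = {i \<in> I. 0 < g i y \<and> g i y < 1}"
  define \<S> where "\<S> = {S. S \<subseteq> I \<and> y \<in> cut_region Y I g S}"
  have finD: "finite D" using assms(1) by (simp add: D_def)
  have dec: "S \<inter> D \<union> {i \<in> I. g i y = 1} = S" if "S \<in> \<S>" for S
  proof -
    from that obtain \<tau> where "S \<subseteq> I" and \<tau>: "0 < \<tau>" "\<tau> < 1" "\<forall>i\<in>S. \<tau> < g i y" "\<forall>i\<in>I - S. g i y < \<tau>"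
      unfolding \<S>_def cut_region_def by blast
    show ?thesis
    proof (intro equalityI subsetI)
      fix i assume "i \<in> S \<inter> D \<union> {i \<in> I. g i y = 1}"
      then show "i \<in> S" using \<tau> by force
    next
      fix i assume "i \<in> S"
      then show "i \<in> S \<inter> D \<union> {i \<in> I. g i y = 1}"
        using \<tau> \<open>S \<subseteq> I\<close> range[of i] unfolding D_def by force
    qed
  qed
  have chain: "S \<subseteq> S' \<or> S' \<subseteq> S" if "S \<in> \<S>" "S' \<in> \<S>" for S S'
  proof (rule ccontr)
    assume "\<not> (S \<subseteq> S' \<or> S' \<subseteq> S)"
    then obtain a b where ab: "a \<in> S" "a \<notin> S'" "b \<in> S'" "b \<notin> S" by blast
    from that have "S \<subseteq> I" "S' \<subseteq> I" by (auto simp: \<S>_def)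
    with ab have "a \<in> I" "b \<in> I" by auto
    from that obtain \<tau> \<tau>' where "\<forall>i\<in>S. \<tau> < g i y" "\<forall>i\<in>I - S. g i y < \<tau>"
      "\<forall>i\<in>S'. \<tau>' < g i y" "\<forall>i\<in>I - S'. g i y < \<tau>'"
      unfolding \<S>_def cut_region_def by blast
    with ab \<open>a \<in> I\<close> \<open>b \<in> I\<close> have "\<tau> < g a y" "g a y < \<tau>'" "\<tau>' < g b y" "g b y < \<tau>"
      by auto
    then show False by linarith
  qed
  \<comment> \<open>By \<open>dec\<close> a member of \<open>\<S>\<close> is determined by its trace on \<open>D\<close>, and the traces form a chain.\<close>
  have "inj_on (\<lambda>S. card (S \<inter> D)) \<S>"
  proof (rule inj_onI)
    fix S S' assume *: "S \<in> \<S>" "S' \<in> \<S>" "card (S \<inter> D) = card (S' \<inter> D)"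
    from chain[OF *(1,2)] have "S \<inter> D \<subseteq> S' \<inter> D \<or> S' \<inter> D \<subseteq> S \<inter> D" by blast
    then have "S \<inter> D = S' \<inter> D"
      using *(3) finD by (metis card_subset_eq finite_Int)
    then show "S = S'" using dec[OF *(1)] dec[OF *(2)] by metis
  qed
  moreover have "(\<lambda>S. card (S \<inter> D)) ` \<S> \<subseteq> {..d}"
  proof -
    have "card (S \<inter> D) \<le> d" for S
      using card_mono[OF finD, of "S \<inter> D"] d unfolding D_def by fastforce
    then show ?thesis by auto
  qed
  ultimately have "card \<S> \<le> card {..d}"
    by (rule card_inj_on_le) simp
  then show ?thesis by (simp add: \<S>_def)
qed

proposition cover_of_small_order:
  assumes "finite I" and ne: "topspace Y \<noteq> {}"
    and cont: "\<And>i. i \<in> I \<Longrightarrow> continuous_map Y euclideanreal (g i)"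
    and range: "\<And>i y. i \<in> I \<Longrightarrow> y \<in> topspace Y \<Longrightarrow> 0 \<le> g i y \<and> g i y \<le> 1"
    and d: "\<And>y. y \<in> topspace Y \<Longrightarrow> card {i \<in> I. 0 < g i y \<and> g i y < 1} \<le> d"
  obtains \<beta> where "finite_open_cover Y \<beta>" "cover_ord Y \<beta> \<le> d"
    "\<And>V. V \<in> \<beta> \<Longrightarrow> \<exists>S \<subseteq> I. (\<forall>y\<in>V. (\<forall>i\<in>S. 0 < g i y) \<and> (\<forall>i\<in>I - S. g i y < 1))"
proof
  let ?\<beta> = "cut_region Y I g ` Pow I"
  have sub: "cut_region Y I g S \<subseteq> topspace Y" for S
    by (auto simp: cut_region_def)
  show "finite_open_cover Y ?\<beta>"
    unfolding finite_open_cover_def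
  proof (intro conjI)
    show "finite ?\<beta>" using assms(1) by simp
    show "\<forall>U\<in>?\<beta>. openin Y U" using openin_cut_region[OF assms(1) _ cont] by auto
    show "\<Union>?\<beta> = topspace Y"
    proof
      show "topspace Y \<subseteq> \<Union>?\<beta>"
      proof
        fix y assume "y \<in> topspace Y"
        from cut_regions_cover[OF assms(1) this, of g] show "y \<in> \<Union>?\<beta>" by blast
      qed
    qed (use sub in blast)
  qed
  have "card {U \<in> ?\<beta>. y \<in> U} \<le> Suc d" if y: "y \<in> topspace Y" for y
  proof -
    have "{U \<in> ?\<beta>. y \<in> U} = cut_region Y I g ` {S. S \<subseteq> I \<and> y \<in> cut_region Y I g S}"
      by auto
    moreover have "finite {S. S \<subseteq> I \<and> y \<in> cut_region Y I g S}"
      using assms(1) by simp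
    ultimately have "card {U \<in> ?\<beta>. y \<in> U} \<le> card {S. S \<subseteq> I \<and> y \<in> cut_region Y I g S}"
      by (simp add: card_image_le)
    also have "\<dots> \<le> Suc d"
      using card_cut_regions_containing_point[OF assms(1), of g y d Y] range[OF _ y] d[OF y] by blast
    finally show ?thesis .
  qed
  moreover from this have "finite ((\<lambda>y. card {U \<in> ?\<beta>. y \<in> U}) ` topspace Y)"
    by (intro finite_subset[OF _ finite_atMost[of "Suc d"]]) auto
  ultimately show "cover_ord Y ?\<beta> \<le> d"
    using ne unfolding cover_ord_def by (simp add: le_diff_conv)
  fix V assume "V \<in> ?\<beta>"
  then obtain S where S: "S \<subseteq> I" "V = cut_region Y I g S" by blast
  have "\<forall>y\<in>V. (\<forall>i\<in>S. 0 < g i y) \<and> (\<forall>i\<in>I - S. g i y < 1)"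
    unfolding S(2) cut_region_def by force
  with S(1) show "\<exists>S \<subseteq> I. (\<forall>y\<in>V. (\<forall>i\<in>S. 0 < g i y) \<and> (\<forall>i\<in>I - S. g i y < 1))"
    by blast
qed

lemma cover_D_le:
  assumes "finite_open_cover T \<beta>" "refines \<beta> \<alpha>" "cover_ord T \<beta> \<le> d"
  shows "cover_D T \<alpha> \<le> d"
proof -
  have "cover_D T \<alpha> \<le> cover_ord T \<beta>"
    unfolding cover_D_def by (rule Least_le) (use assms(1,2) in blast)
  with assms(3) show ?thesis by simp
qed

text \<open>The coordinates of the cube are the pairs \<open>(t, U)\<close>.  On a nonempty star of a vertex \<open>S\<close> each \<open>t\<close>
  has some \<open>(t, U) \<in> S\<close>, because \<open>g t U\<close> attains 1 for some \<open>U\<close> at each point;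
  positivity of \<open>g t U\<close> then keeps the star inside \<open>W t U\<close>.  In the application \<open>t\<close> runs
  through the eigenvalue maps and \<open>W t U\<close> is a preimage of \<open>U\<close>.\<close>

proposition cover_D_join_le:
  assumes fT: "finite T" and fC: "\<And>t. t \<in> T \<Longrightarrow> finite (C t)" and ne: "topspace Y \<noteq> {}"
    and cont: "\<And>t U. t \<in> T \<Longrightarrow> U \<in> C t \<Longrightarrow> continuous_map Y euclideanreal (g t U)"
    and range: "\<And>t U y. t \<in> T \<Longrightarrow> U \<in> C t \<Longrightarrow> y \<in> topspace Y \<Longrightarrow> 0 \<le> g t U y \<and> g t U y \<le> 1"
    and supp: "\<And>t U y. t \<in> T \<Longrightarrow> U \<in> C t \<Longrightarrow> y \<in> topspace Y \<Longrightarrow> 0 < g t U y \<Longrightarrow> y \<in> W t U"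
    and one: "\<And>t y. t \<in> T \<Longrightarrow> y \<in> topspace Y \<Longrightarrow> \<exists>U \<in> C t. g t U y = 1"
    and d: "\<And>y. y \<in> topspace Y \<Longrightarrow> card {(t, U). t \<in> T \<and> U \<in> C t \<and> 0 < g t U y \<and> g t U y < 1} \<le> d"
  shows "cover_D Y (cover_join Y T (\<lambda>t. W t ` C t)) \<le> d"
proof -
  define I where "I = Sigma T C"
  have fI: "finite I" using fT fC by (simp add: I_def)
  have cd: "card {i \<in> I. 0 < case_prod g i y \<and> case_prod g i y < 1} \<le> d" if "y \<in> topspace Y" for y
  proof -
    have "{i \<in> I. 0 < case_prod g i y \<and> case_prod g i y < 1}
        = {(t, U). t \<in> T \<and> U \<in> C t \<and> 0 < g t U y \<and> g t U y < 1}"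
      by (auto simp: I_def)
    with d[OF that] show ?thesis by simp
  qed
  obtain \<beta> where \<beta>: "finite_open_cover Y \<beta>" "cover_ord Y \<beta> \<le> d"
    "\<And>V. V \<in> \<beta> \<Longrightarrow> \<exists>S \<subseteq> I. (\<forall>y\<in>V. (\<forall>i\<in>S. 0 < case_prod g i y) \<and> (\<forall>i\<in>I - S. case_prod g i y < 1))"
    by (rule cover_of_small_order[OF fI ne, of "case_prod g" d])
      (use cont range cd in \<open>auto simp: I_def\<close>)
  have "refines \<beta> (cover_join Y T (\<lambda>t. W t ` C t))"
    unfolding refines_def
  proof
    fix V assume V: "V \<in> \<beta>"
    then have VY: "V \<subseteq> topspace Y" using \<beta>(1) by (auto simp: finite_open_cover_def)
    obtain S where S: "S \<subseteq> I" "\<And>y i. y \<in> V \<Longrightarrow> i \<in> S \<Longrightarrow> 0 < case_prod g i y"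
      "\<And>y i. y \<in> V \<Longrightarrow> i \<in> I - S \<Longrightarrow> case_prod g i y < 1"
      using \<beta>(3)[OF V] by blast
    have "\<exists>U \<in> C t. V \<subseteq> W t U" if t: "t \<in> T" for t
    proof (cases "V = {}")
      case True
      then show ?thesis using one[OF t] ne by blast
    next
      case False
      then obtain y where y: "y \<in> V" by blast
      then obtain U where U: "U \<in> C t" "g t U y = 1" using one[OF t] VY by blast
      have "(t, U) \<in> S" using S(3)[OF y, of "(t, U)"] U t by (auto simp: I_def)
      then have "V \<subseteq> W t U" using S(2)[of _ "(t, U)"] supp[OF t U(1)] VY by fastforce
      with U(1) show ?thesis by blast
    qed
    then obtain U where U: "\<And>t. t \<in> T \<Longrightarrow> U t \<in> C t \<and> V \<subseteq> W t (U t)" by metis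
    have "topspace Y \<inter> (\<Inter>t\<in>T. (\<lambda>t\<in>T. W t (U t)) t) \<in> cover_join Y T (\<lambda>t. W t ` C t)"
      unfolding cover_join_def using U by (intro imageI) auto
    moreover have "V \<subseteq> topspace Y \<inter> (\<Inter>t\<in>T. (\<lambda>t\<in>T. W t (U t)) t)"
      using U VY by auto
    ultimately show "\<exists>U\<in>cover_join Y T (\<lambda>t. W t ` C t). V \<subseteq> U" by blast
  qed
  then show ?thesis by (rule cover_D_le[OF \<beta>(1) _ \<beta>(2)])
qed

section \<open>Bump functions that are fractional only near a boundary\<close>

text \<open>In a metric space that is not geodesic, a point at small distance from \<open>U'\<close> may be far from the
  boundary of \<open>U'\<close>, so an explicit function of the distance to \<open>U'\<close> would not work.  Instead,
  the Urysohn function is forced to vanish off the open set \<open>U' \<union> N\<close>, where \<open>N\<close> is the open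
  neighbourhood of radius \<open>\<delta>\<close> of the boundary.  This set contains the closure of \<open>U'\<close>,
  where the function is 1, so fractional values are possible only in \<open>N\<close>.\<close>

lemma bump_function:
  fixes X :: "'x metric"
  assumes U: "openin (mtopology_of X) U" and U': "openin (mtopology_of X) U'"
    and cl: "mtopology_of X closure_of U' \<subseteq> U" and "0 < \<delta>"
  shows "\<exists>h. continuous_map (mtopology_of X) euclideanreal h \<and>
     (\<forall>x \<in> mspace X. 0 \<le> h x \<and> h x \<le> 1 \<and> (x \<in> U' \<longrightarrow> h x = 1) \<and> (0 < h x \<longrightarrow> x \<in> U) \<and>
        (0 < h x \<and> h x < 1 \<longrightarrow> x \<in> closed_nbhd X (mtopology_of X frontier_of U') \<delta>))"
proof -
  let ?T = "mtopology_of X"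
  let ?N = "\<Union>y \<in> ?T frontier_of U'. mball_of X y \<delta>"
  interpret M: Metric_space "mspace X" "mdist X" by simp
  have T: "?T = M.mtopology" by (simp add: mtopology_of_def)
  have B: "mball_of X y \<delta> = M.mball y \<delta>" for y by (simp add: mball_of_def)
  have "normal_space ?T"
    unfolding T by (rule M.normal_space_mtopology)
  moreover have "openin ?T ?N"
    unfolding T B by (intro openin_Union) auto
  then have O: "openin ?T (U \<inter> (U' \<union> ?N))"
    by (intro openin_Int openin_Un U U')
  then have "closedin ?T (mspace X - U \<inter> (U' \<union> ?N))"
    by (metis closedin_def closedin_diff closedin_topspace topspace_mtopology_of)
  moreover have fr: "?T frontier_of U' \<subseteq> ?N"
    using \<open>0 < \<delta>\<close> frontier_of_subset_topspace[of ?T U'] by force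
  have cl_eq: "?T closure_of U' = U' \<union> ?T frontier_of U'"
    using interior_of_union_frontier_of[of ?T U'] interior_of_openin[OF U'] by simp
  then have "disjnt (mspace X - U \<inter> (U' \<union> ?N)) (?T closure_of U')"
    using cl fr unfolding disjnt_def by auto
  ultimately obtain h where h: "continuous_map ?T (top_of_set {0..1::real}) h"
    "h ` (mspace X - U \<inter> (U' \<union> ?N)) \<subseteq> {0}" "h ` (?T closure_of U') \<subseteq> {1}"
    using Urysohn_lemma[of ?T "mspace X - U \<inter> (U' \<union> ?N)" "?T closure_of U'" 0 1] by auto
  have one: "h x = 1" if "x \<in> U'" for x
    using h(3) that cl_eq by auto
  have zero: "h x = 0" if "x \<in> mspace X" "x \<notin> U \<inter> (U' \<union> ?N)" for x
    using h(2) that by blast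
  have N: "?N \<subseteq> closed_nbhd X (?T frontier_of U') \<delta>"
    unfolding closed_nbhd_def mball_of_def mcball_of_def using M.mball_subset_mcball by blast
  have "continuous_map ?T euclideanreal h" "\<forall>x\<in>mspace X. 0 \<le> h x \<and> h x \<le> 1"
    using h(1) by (auto simp: continuous_map_in_subtopology image_subset_iff Pi_iff)
  moreover have "x \<in> closed_nbhd X (?T frontier_of U') \<delta>" if "x \<in> mspace X" "0 < h x" "h x < 1" for x
    using one[of x] zero[of x] that N by fastforce
  moreover have "x \<in> U" if "x \<in> mspace X" "0 < h x" for x
    using zero[of x] that by fastforce
  ultimately show ?thesis using one by blast
qed

text \<open>A substitute for a partition of unity: instead of adding up to 1, at each point some
  function attains 1.  The set \<open>E\<close> contains all points with fractional values.\<close>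

definition bump_family :: "'x metric \<Rightarrow> 'x set set \<Rightarrow> ('x set \<Rightarrow> 'x \<Rightarrow> real) \<Rightarrow> 'x set \<Rightarrow> bool" where
  "bump_family X \<alpha> h E \<longleftrightarrow>
     (\<forall>U \<in> \<alpha>. continuous_map (mtopology_of X) euclideanreal (h U) \<and>
        (\<forall>x \<in> mspace X. 0 \<le> h U x \<and> h U x \<le> 1 \<and> (0 < h U x \<longrightarrow> x \<in> U) \<and>
           (0 < h U x \<and> h U x < 1 \<longrightarrow> x \<in> E))) \<and>
     (\<forall>x \<in> mspace X. \<exists>U \<in> \<alpha>. h U x = 1)"

lemma bump_family_of_shrinking:
  assumes \<alpha>: "finite_open_cover (mtopology_of X) \<alpha>" and \<alpha>': "finite_open_cover (mtopology_of X) \<alpha>'"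
    and f: "bij_betw f \<alpha> \<alpha>'" "\<forall>U \<in> \<alpha>. mtopology_of X closure_of (f U) \<subseteq> U" and \<delta>: "0 < \<delta>"
  shows "\<exists>h. bump_family X \<alpha> h (\<Union>U' \<in> \<alpha>'. closed_nbhd X (mtopology_of X frontier_of U') \<delta>)"
proof -
  have fU: "f U \<in> \<alpha>'" if "U \<in> \<alpha>" for U
    using f(1) that by (auto simp: bij_betw_def)
  have "\<exists>h. continuous_map (mtopology_of X) euclideanreal h \<and>
      (\<forall>x \<in> mspace X. 0 \<le> h x \<and> h x \<le> 1 \<and> (x \<in> f U \<longrightarrow> h x = 1) \<and> (0 < h x \<longrightarrow> x \<in> U) \<and>
        (0 < h x \<and> h x < 1 \<longrightarrow> x \<in> closed_nbhd X (mtopology_of X frontier_of (f U)) \<delta>))"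
    if U: "U \<in> \<alpha>" for U
  proof (rule bump_function)
    show "openin (mtopology_of X) U" using \<alpha> U by (auto simp: finite_open_cover_def)
    show "openin (mtopology_of X) (f U)" using \<alpha>' fU[OF U] by (auto simp: finite_open_cover_def)
  qed (use f(2) U \<delta> in auto)
  then obtain h where h: "\<And>U. U \<in> \<alpha> \<Longrightarrow> continuous_map (mtopology_of X) euclideanreal (h U) \<and>
      (\<forall>x \<in> mspace X. 0 \<le> h U x \<and> h U x \<le> 1 \<and> (x \<in> f U \<longrightarrow> h U x = 1) \<and> (0 < h U x \<longrightarrow> x \<in> U) \<and>
        (0 < h U x \<and> h U x < 1 \<longrightarrow> x \<in> closed_nbhd X (mtopology_of X frontier_of (f U)) \<delta>))"
    by metis
  have "\<exists>U \<in> \<alpha>. h U x = 1" if x: "x \<in> mspace X" for x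
  proof -
    have "x \<in> \<Union>\<alpha>'" using \<alpha>' x by (simp add: finite_open_cover_def)
    then obtain U where "U \<in> \<alpha>" "x \<in> f U" using f(1) by (auto simp: bij_betw_def)
    then show ?thesis using h x by blast
  qed
  then have "bump_family X \<alpha> h (\<Union>U' \<in> \<alpha>'. closed_nbhd X (mtopology_of X frontier_of U') \<delta>)"
    unfolding bump_family_def using h fU by blast
  then show ?thesis by blast
qed

section \<open>Mean dimension\<close>

text \<open>The existential statement that SBRP makes about a single \<open>X\<^sub>j\<^sub>,\<^sub>k\<close>.\<close>

definition small_boundary_refinement ::
    "('x, 'm) ah_eig_system_scheme \<Rightarrow> nat \<Rightarrow> nat \<Rightarrow> nat \<Rightarrow> nat \<Rightarrow> 'x set set \<Rightarrow> real \<Rightarrow> bool" where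
  "small_boundary_refinement S i l j k \<alpha> \<epsilon> \<longleftrightarrow>
     (\<exists>\<alpha>' \<delta> f. finite_open_cover (base_top S i l) \<alpha>' \<and> refines \<alpha>' \<alpha> \<and> 0 < \<delta> \<and>
        bij_betw f \<alpha> \<alpha>' \<and> (\<forall>U \<in> \<alpha>. base_top S i l closure_of (f U) \<subseteq> U) \<and>
        ocap S i l j k (\<Union>U' \<in> \<alpha>'. closed_nbhd (base S i l) (base_top S i l frontier_of U') \<delta>) < \<epsilon>)"

lemma finite_open_cover_induced:
  assumes "finite_open_cover (stage_top S i) \<alpha>" "l < summands S i"
  shows "finite_open_cover (base_top S i l) (induced_cover \<alpha> l)"
proof -
  have "openin (base_top S i l) (Pair l -` U)" if "U \<in> \<alpha>" for U
  proof -
    have "openin (stage_top S i) U" using assms(1) that by (auto simp: finite_open_cover_def)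
    then show ?thesis
      using assms(2) by (simp add: stage_top_def openin_sum_topology vimage_def)
  qed
  moreover have "(\<Union>U\<in>\<alpha>. Pair l -` U) = mspace (base S i l)"
  proof -
    have "\<Union>\<alpha> = Sigma {..<summands S i} (\<lambda>l. mspace (base S i l))"
      using assms(1) by (simp add: finite_open_cover_def stage_top_def comp_def)
    then show ?thesis
      using assms(2) by (auto simp: set_eq_iff)
  qed
  ultimately show ?thesis
    using assms(1) by (auto simp: finite_open_cover_def induced_cover_def)
qed

text \<open>The supremum over an empty set of covers would be \<open>-\<infinity>\<close> instead of 0.  The cover by the
  summands \<open>X\<^sub>i\<^sub>,\<^sub>l\<close> is admissible, as these are connected.\<close>

lemma stage_covers_nonempty:
  assumes "is_ah_system S"
  shows "stage_covers S i \<noteq> {}"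
proof -
  let ?C = "\<lambda>l. Pair l ` mspace (base S i l)"
  have conn: "connectedin (stage_top S i) (?C l)" if l: "l < summands S i" for l
  proof -
    have "continuous_map (base_top S i l) (stage_top S i) (Pair l)"
      using l unfolding stage_top_def by (intro continuous_map_component_injection) simp
    moreover have "connectedin (base_top S i l) (mspace (base S i l))"
      using assms l unfolding is_ah_system_def
      by (metis connectedin_topspace topspace_mtopology_of)
    ultimately show ?thesis by (rule connectedin_continuous_map_image)
  qed
  have top: "topspace (stage_top S i) = (\<Union>l<summands S i. ?C l)"
    by (auto simp: stage_top_def)
  have "topspace (stage_top S i) \<noteq> {}"
    using assms unfolding top is_ah_system_def
    by (metis (no_types, lifting) SUP_bot_conv(1) image_is_empty lessThan_iff less_one linorder_not_less not_gr_zero zero_less_iff_neq_zero)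
  then have ne: "stage_top S i \<noteq> trivial_topology" by auto
  have "openin (stage_top S i) (?C l)" if l: "l < summands S i" for l
  proof -
    have "{x. (l', x) \<in> ?C l} = (if l' = l then topspace (base_top S i l) else {})" for l'
      by auto
    then show ?thesis
      using l openin_topspace[of "base_top S i l"] unfolding stage_top_def openin_sum_topology by auto
  qed
  then have "?C ` {..<summands S i} \<in> stage_covers S i"
    using exists_connected_component_of_superset[OF conn ne]
    unfolding stage_covers_def finite_open_cover_def top by blast
  then show ?thesis by blast
qed

text \<open>The factor \<open>rk S i l \<ge> 1\<close> of the orbit capacity is dropped.\<close>

lemma card_hits_le_ocap:
  assumes "is_ah_system S" "l < summands S i" "k < summands S j" "x \<in> mspace (base S j k)"
  shows "real (card {m. m < npts S i j l k \<and> eig S i j l k m x \<in> E}) \<le> real (rk S j k) * ocap S i l j k E"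
proof -
  let ?c = "\<lambda>x. real (card {m. m < npts S i j l k \<and> eig S i j l k m x \<in> E})"
  have rk: "1 \<le> rk S i l" "1 \<le> rk S j k"
    using assms by (auto simp: is_ah_system_def)
  have c: "?c x \<le> real (npts S i j l k)" for x
    using card_mono[of "{..<npts S i j l k}" "{m. m < npts S i j l k \<and> eig S i j l k m x \<in> E}"] by auto
  have "real (rk S i l) / real (rk S j k) * ?c x \<le> ocap S i l j k E"
    unfolding ocap_def
  proof (rule cSUP_upper)
    show "x \<in> mspace (base S j k)" by fact
    show "bdd_above ((\<lambda>x. real (rk S i l) / real (rk S j k) * ?c x) ` mspace (base S j k))"
      by (rule bdd_aboveI2, rule mult_left_mono[OF c]) simp
  qed
  then have "real (rk S i l) * ?c x \<le> real (rk S j k) * ocap S i l j k E"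
    using rk by (simp add: field_simps)
  moreover have "1 * ?c x \<le> real (rk S i l) * ?c x"
    using rk by (intro mult_right_mono) auto
  ultimately show ?thesis by linarith
qed

text \<open>The fractional coordinates at \<open>y\<close> are pairs of an eigenvalue map that sends \<open>y\<close> near a boundary
  and a member of the cover.  For each \<open>l\<close> there are at most \<open>\<epsilon> * rk S j k\<close> such eigenvalue maps
  by the bound on the orbit capacity.  This is what makes the order of the cover small relative to
  the rank.\<close>

proposition cover_D_pullback_le:
  assumes ah: "is_ah_system S" and eig: "eig_patterns_induced S"
    and \<alpha>: "finite_open_cover (stage_top S i) \<alpha>" and ij: "i < j" and k: "k < summands S j"
    and sb: "\<And>l. l < summands S i \<Longrightarrow> small_boundary_refinement S i l j k (induced_cover \<alpha> l) \<epsilon>"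
  shows "real (cover_D (base_top S j k) (pullback_cover S i j k \<alpha>))
    \<le> real (rk S j k) * (\<epsilon> * (\<Sum>l<summands S i. real (card (induced_cover \<alpha> l))))"
proof -
  let ?C = "induced_cover \<alpha>"
  let ?Y = "base_top S j k"
  define T where "T = (SIGMA l:{..<summands S i}. {..<npts S i j l k})"
  have foc: "finite_open_cover (base_top S i l) (?C l)" if "l < summands S i" for l
    by (rule finite_open_cover_induced[OF \<alpha> that])
  have cont_eig: "continuous_map ?Y (base_top S i l) (eig S i j l k m)"
    if "l < summands S i" "m < npts S i j l k" for l m
    using eig that ij k unfolding eig_patterns_induced_def by blast
  have eig_in: "eig S i j l k m y \<in> mspace (base S i l)"
    if "l < summands S i" "m < npts S i j l k" "y \<in> mspace (base S j k)" for l m y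
    using continuous_map_image_subset_topspace[OF cont_eig[OF that(1,2)]] that(3) by auto
  have "\<exists>h E. bump_family (base S i l) (?C l) h E \<and> ocap S i l j k E < \<epsilon>"
    if l: "l < summands S i" for l
    using sb[OF l] bump_family_of_shrinking[OF foc[OF l]] unfolding small_boundary_refinement_def
    by metis
  then obtain h E where fam: "\<And>l. l < summands S i \<Longrightarrow> bump_family (base S i l) (?C l) (h l) (E l)"
    and cap: "\<And>l. l < summands S i \<Longrightarrow> ocap S i l j k (E l) < \<epsilon>"
    by metis
  have cont_h: "continuous_map (base_top S i l) euclideanreal (h l U)"
    if "l < summands S i" "U \<in> ?C l" for l U
    using fam[OF that(1)] that(2) by (simp add: bump_family_def)
  have h: "0 \<le> h l U x \<and> h l U x \<le> 1 \<and> (0 < h l U x \<longrightarrow> x \<in> U) \<and> (0 < h l U x \<and> h l U x < 1 \<longrightarrow> x \<in> E l)"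
    if "l < summands S i" "U \<in> ?C l" "x \<in> mspace (base S i l)" for l U x
    using fam[OF that(1)] that(2,3) by (simp add: bump_family_def)
  have h_one: "\<exists>U \<in> ?C l. h l U x = 1" if "l < summands S i" "x \<in> mspace (base S i l)" for l x
    using fam[OF that(1)] that(2) by (simp add: bump_family_def)
  define b where "b = real (rk S j k) * (\<epsilon> * (\<Sum>l<summands S i. real (card (?C l))))"
  define g where "g = (\<lambda>(l, m) U y. h l U (eig S i j l k m y))"
  let ?hits = "\<lambda>y l. {m. m < npts S i j l k \<and> eig S i j l k m y \<in> E l}"
  have count: "real (card {(t, U). t \<in> T \<and> U \<in> ?C (fst t) \<and> 0 < g t U y \<and> g t U y < 1}) \<le> b"
    (is "real (card ?F) \<le> b") if y: "y \<in> mspace (base S j k)" for y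
  proof -
    let ?G = "SIGMA l:{..<summands S i}. ?hits y l \<times> ?C l"
    have fin: "finite (?hits y l \<times> ?C l)" if "l < summands S i" for l
      using foc[OF that] by (auto simp: finite_open_cover_def)
    have "?F \<subseteq> (\<lambda>(l, m, U). ((l, m), U)) ` ?G"
    proof
      fix z assume "z \<in> ?F"
      then obtain l m U where z: "z = ((l, m), U)" "l < summands S i" "m < npts S i j l k" "U \<in> ?C l"
        "0 < h l U (eig S i j l k m y)" "h l U (eig S i j l k m y) < 1"
        by (auto simp: T_def g_def)
      then have "eig S i j l k m y \<in> E l"
        using h eig_in y by blast
      then show "z \<in> (\<lambda>(l, m, U). ((l, m), U)) ` ?G"
        using z by (intro image_eqI[of _ _ "(l, m, U)"]) auto
    qed
    moreover have "finite ?G" using fin by auto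
    ultimately have "card ?F \<le> card ?G"
      by (rule surj_card_le[rotated])
    also have "card ?G = (\<Sum>l<summands S i. card (?hits y l) * card (?C l))"
      using fin by (simp add: card_cartesian_product)
    finally have "real (card ?F) \<le> (\<Sum>l<summands S i. real (card (?hits y l)) * real (card (?C l)))"
      by (simp only: of_nat_le_iff flip: of_nat_mult of_nat_sum)
    also have "\<dots> \<le> (\<Sum>l<summands S i. real (rk S j k) * \<epsilon> * real (card (?C l)))"
    proof (rule sum_mono, rule mult_right_mono)
      fix l assume "l \<in> {..<summands S i}"
      then have l: "l < summands S i" by simp
      have "real (card (?hits y l)) \<le> real (rk S j k) * ocap S i l j k (E l)"
        by (rule card_hits_le_ocap[OF ah l k y])
      also have "\<dots> \<le> real (rk S j k) * \<epsilon>"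
        using cap[OF l] by (intro mult_left_mono) auto
      finally show "real (card (?hits y l)) \<le> real (rk S j k) * \<epsilon>" .
    qed simp
    also have "\<dots> = b" by (simp add: b_def sum_distrib_left mult.assoc)
    finally show ?thesis .
  qed
  have ne: "mspace (base S j k) \<noteq> {}" using ah k by (simp add: is_ah_system_def)
  then have b0: "0 \<le> b" using count by (meson all_not_in_conv of_nat_0_le_iff order_trans)
  let ?W = "\<lambda>(l, m) U. {x \<in> mspace (base S j k). eig S i j l k m x \<in> U}"
  have "pullback_cover S i j k \<alpha> = cover_join ?Y T (\<lambda>t. ?W t ` ?C (fst t))"
    unfolding pullback_cover_def T_def by (intro arg_cong[of _ _ "cover_join _ _"]) auto
  moreover have "cover_D ?Y (cover_join ?Y T (\<lambda>t. ?W t ` ?C (fst t))) \<le> nat \<lfloor>b\<rfloor>"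
  proof (rule cover_D_join_le[where g = g])
    show "finite T" by (simp add: T_def)
    show "topspace ?Y \<noteq> {}" using ne by simp
    fix t assume t: "t \<in> T"
    then obtain l m where lm: "t = (l, m)" "l < summands S i" "m < npts S i j l k"
      by (auto simp: T_def)
    show "finite (?C (fst t))" using foc[OF lm(2)] lm(1) by (simp add: finite_open_cover_def)
    show "\<exists>U \<in> ?C (fst t). g t U y = 1" if "y \<in> topspace ?Y" for y
      using h_one[OF lm(2)] eig_in[OF lm(2,3)] that lm(1) by (auto simp: g_def)
    fix U assume U: "U \<in> ?C (fst t)"
    have "continuous_map ?Y euclideanreal (h l U \<circ> eig S i j l k m)"
      using cont_h[OF lm(2)] cont_eig[OF lm(2,3)] U lm(1) continuous_map_compose by fastforce
    then show "continuous_map ?Y euclideanreal (g t U)"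
      by (simp add: g_def lm(1) comp_def)
    fix y assume y: "y \<in> topspace ?Y"
    then have y': "eig S i j l k m y \<in> mspace (base S i l)" using eig_in[OF lm(2,3)] by simp
    show "0 \<le> g t U y \<and> g t U y \<le> 1" using h[OF lm(2) _ y'] U lm(1) by (simp add: g_def)
    show "y \<in> ?W t U" if "0 < g t U y" using h[OF lm(2) _ y'] U lm(1) that y by (simp add: g_def)
  next
    fix y assume "y \<in> topspace ?Y"
    then show "card {(t, U). t \<in> T \<and> U \<in> ?C (fst t) \<and> 0 < g t U y \<and> g t U y < 1} \<le> nat \<lfloor>b\<rfloor>"
      using count[of y] by (simp add: le_nat_floor)
  qed
  ultimately have "cover_D ?Y (pullback_cover S i j k \<alpha>) \<le> nat \<lfloor>b\<rfloor>" by simp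
  then show ?thesis using b0 unfolding b_def[symmetric] by linarith
qed

text \<open>The number of sets in the cover of \<open>X\<^sub>i\<close> is fixed before \<open>\<epsilon>\<close> is chosen, so it can be
  compensated for in the choice of \<open>\<epsilon>\<close>.\<close>

lemma SBRP_imp_cover_D_ratio_tendsto_0:
  assumes ah: "is_ah_system S" and eig: "eig_patterns_induced S" and sbrp: "SBRP S"
    and \<alpha>: "finite_open_cover (stage_top S i) \<alpha>"
  shows "(\<lambda>j. Max ((\<lambda>k. real (cover_D (base_top S j k) (pullback_cover S i j k \<alpha>))
                 / real (rk S j k)) ` {..<summands S j})) \<longlonglongrightarrow> 0"
    (is "(\<lambda>j. Max (?r j ` _)) \<longlonglongrightarrow> 0")
proof (rule LIMSEQ_I)
  fix e :: real assume "0 < e"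
  define c where "c = (\<Sum>l<summands S i. real (card (induced_cover \<alpha> l)))"
  define \<epsilon> where "\<epsilon> = e / (c + 1)"
  have "0 \<le> c" by (simp add: c_def sum_nonneg)
  with \<open>0 < e\<close> have \<epsilon>: "0 < \<epsilon>" "\<epsilon> * c < e" by (auto simp: \<epsilon>_def field_simps)
  have "\<exists>L. \<forall>j > L. \<forall>k < summands S j. small_boundary_refinement S i l j k (induced_cover \<alpha> l) \<epsilon>"
    if "l < summands S i" for l
    using sbrp[unfolded SBRP_def] that finite_open_cover_induced[OF \<alpha> that] \<epsilon>(1)
    unfolding small_boundary_refinement_def by blast
  then obtain L where L: "\<And>l j k. l < summands S i \<Longrightarrow> L l < j \<Longrightarrow> k < summands S j \<Longrightarrow>
      small_boundary_refinement S i l j k (induced_cover \<alpha> l) \<epsilon>"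
    by metis
  define J where "J = Max (insert i (L ` {..<summands S i}))"
  have "norm (Max (?r j ` {..<summands S j}) - 0) < e" if "Suc J \<le> j" for j
  proof -
    have "i \<le> J" "\<And>l. l < summands S i \<Longrightarrow> L l \<le> J"
      by (auto simp: J_def)
    with that have j: "i < j" "\<And>l. l < summands S i \<Longrightarrow> L l < j"
      by (auto simp: Suc_le_eq intro: le_less_trans)
    have "?r j k \<le> \<epsilon> * c" if k: "k < summands S j" for k
    proof -
      have "1 \<le> rk S j k" using ah k by (simp add: is_ah_system_def)
      then show ?thesis
        using cover_D_pullback_le[OF ah eig \<alpha> j(1) k L[OF _ j(2) k]]
        by (simp add: c_def field_simps)
    qed
    then have r: "\<And>k. k < summands S j \<Longrightarrow> 0 \<le> ?r j k \<and> ?r j k < e"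
      using \<epsilon>(2) by fastforce
    have "1 \<le> summands S j" using ah by (simp add: is_ah_system_def)
    then have "Max (?r j ` {..<summands S j}) \<in> ?r j ` {..<summands S j}"
      by (intro Max_in) (auto simp: lessThan_empty_iff)
    with r show ?thesis by auto
  qed
  then show "\<exists>n0. \<forall>j\<ge>n0. norm (Max (?r j ` {..<summands S j}) - 0) < e" by blast
qed

theorem theorem3p18:
  fixes S :: "'x ah_eig_system"
    and A :: "'a cstar"
    and \<psi> :: "nat \<Rightarrow> (nat \<Rightarrow> 'x \<Rightarrow> complex mat) \<Rightarrow> 'a"
  assumes "is_ah_system S"
    and "is_inductive_limit S A \<psi>"
    and "simple_cstar_algebra A"
    and "eig_patterns_induced S"
    and "SBRP S"
  shows "mean_dimension S = 0"
proof -
  have "mean_dim_stage S i = 0" for i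
  proof -
    have "lim (\<lambda>j. ereal (Max ((\<lambda>k. real (cover_D (base_top S j k) (pullback_cover S i j k \<alpha>))
        / real (rk S j k)) ` {..<summands S j}))) = 0" if "\<alpha> \<in> stage_covers S i" for \<alpha>
    proof (rule limI)
      have "finite_open_cover (stage_top S i) \<alpha>"
        using that by (simp add: stage_covers_def)
      from SBRP_imp_cover_D_ratio_tendsto_0[OF assms(1,4,5) this]
      show "(\<lambda>j. ereal (Max ((\<lambda>k. real (cover_D (base_top S j k) (pullback_cover S i j k \<alpha>))
        / real (rk S j k)) ` {..<summands S j}))) \<longlonglongrightarrow> 0"
        unfolding zero_ereal_def by (rule tendsto_ereal)
    qed
    then show ?thesis
      unfolding mean_dim_stage_def using stage_covers_nonempty[OF assms(1)] by simp
  qed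
  then have "mean_dim_stage S = (\<lambda>i. 0)" by blast
  then show ?thesis unfolding mean_dimension_def by (simp add: limI)
qed

end
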